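(* Let $k\ge 1$ be an integer. Let $G_L$ be an $\ell$-$LP_0$-snark with $\ell\ge3$ odd. Then $\gamma_{[kR]}(G_L)\le 2(k+1)\ell$.
   Context: A basic block $B_i$ has vertices $p_i,q_i,r_i,s_i,t_i,u_i,v_i$ and edges $p_it_i,t_iq_i,q_ir_i,r_is_i,s_ip_i,u_iv_i,u_ip_i,v_iq_i$. For odd $\ell\ge3$, an $\ell$-$LP_1$-snark is built from disjoint blocks $B_0,\ldots,B_{\ell-1}$: for each $i\in\{0,\ldots,\ell-1\}$ (indices modulo $\ell$) add either the pair of edges $\{s_ir_{i+1},v_iu_{i+1}\}$ or the pair $\{s_iu_{i+1},v_ir_{i+1}\}$; then choose an odd number $\sigma$ with $1\le\sigma\le\lfloor\ell/3\rfloor$ of pairwise disjoint triples $\{t_i,t_j,t_s\}$ and for each add a new vertex (link-vertex) adjacent to its three vertices; finally, the remaining $\ell-3\sigma$ vertices $t_i$ are paired up and each pair is joined by an edge (repairing edge). An $\ell$-$LP_0$-snark is an $\ell$-$LP_1$-snark in which every link-vertex is adjacent to $t_i,t_{i+1},t_{i+2}$ for some $i$ and every repairing edge is of the form $t_it_{i+1}$ (indices modulo $\ell$). For $f\colon V(G)\to\mathbb{Z}_{\ge 0}$ and $S\subseteq V(G)$, $f(S)=\sum_{v\in S}f(v)$, and $AN(v)=\{w\in N(v): f(w)\ge 1\}$. A $[k]$-Roman dominating function of $G$ is a function $f\colon V(G)\to\{0,1,\ldots,k+1\}$ such that $f(N[v])\ge k+|AN(v)|$ for every vertex $v$ with $f(v)<k$;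 its weight is $f(V(G))$. $\gamma_{[kR]}(G)$ is the minimum weight of such a function. *)

theory Defs
  imports "HOL-Library.Disjoint_Sets"
begin

text \<open>
  A finite simple graph is given by its vertex set \<open>V\<close> and its set \<open>E\<close> of two-element edges.
\<close>

definition neighborhood :: "'a set set \<Rightarrow> 'a \<Rightarrow> 'a set" where
  "neighborhood E v = {w. {v, w} \<in> E \<and> w \<noteq> v}"

definition closed_neighborhood :: "'a set set \<Rightarrow> 'a \<Rightarrow> 'a set" where
  "closed_neighborhood E v = insert v (neighborhood E v)"

definition active_neighborhood :: "'a set set \<Rightarrow> ('a \<Rightarrow> nat) \<Rightarrow> 'a \<Rightarrow> 'a set" where
  "active_neighborhood E f v = {w \<in> neighborhood E v. f w \<ge> 1}"

text \<open>
  Functions on \<open>V\<close> are represented by total functions; their values outside \<open>V\<close> play no role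
  as long as the edges are subsets of \<open>V\<close>.
\<close>

definition roman_dominating :: "nat \<Rightarrow> 'a set \<Rightarrow> 'a set set \<Rightarrow> ('a \<Rightarrow> nat) \<Rightarrow> bool" where
  "roman_dominating k V E f \<longleftrightarrow>
     (\<forall>v\<in>V. f v \<le> k + 1) \<and>
     (\<forall>v\<in>V. f v < k \<longrightarrow>
        sum f (closed_neighborhood E v) \<ge> k + card (active_neighborhood E f v))"

definition roman_domination_number :: "nat \<Rightarrow> 'a set \<Rightarrow> 'a set set \<Rightarrow> nat" where
  "roman_domination_number k V E = (LEAST w. \<exists>f. roman_dominating k V E f \<and> w = sum f V)"

text \<open>
  The minimum is attained, so the \<open>LEAST\<close> above is never an unspecified value.
\<close>

lemma roman_domination_number_attained:
  "\<exists>f. roman_dominating k V E f \<and> roman_domination_number k V E = sum f V"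
  unfolding roman_domination_number_def
proof (rule LeastI_ex)
  have "roman_dominating k V E (\<lambda>_. k + 1)"
    by (simp add: roman_dominating_def)
  then show "\<exists>w f. roman_dominating k V E f \<and> w = sum f V"
    by blast
qed

definition graph_isomorphic ::
    "'a set \<Rightarrow> 'a set set \<Rightarrow> 'b set \<Rightarrow> 'b set set \<Rightarrow> bool" where
  "graph_isomorphic V E V' E' \<longleftrightarrow> (\<exists>h. bij_betw h V V' \<and> E' = (`) h ` E)"

text \<open>
  The vertices \<open>p\<^sub>i, q\<^sub>i, r\<^sub>i, s\<^sub>i, t\<^sub>i, u\<^sub>i, v\<^sub>i\<close> of the blocks are \<open>vp i, \<dots>, vv i\<close>.  The link-vertex
  adjacent to \<open>t\<^sub>a, t\<^sub>b, t\<^sub>c\<close> is \<open>link {a, b, c}\<close>; this is unambiguous because the chosen triples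
  are pairwise disjoint.
\<close>

datatype snark_vertex =
  vp nat | vq nat | vr nat | vs nat | vt nat | vu nat | vv nat | link "nat set"

definition block_vertices :: "nat \<Rightarrow> snark_vertex set" where
  "block_vertices i = {vp i, vq i, vr i, vs i, vt i, vu i, vv i}"

definition block_edges :: "nat \<Rightarrow> snark_vertex set set" where
  "block_edges i =
     {{vp i, vt i}, {vt i, vq i}, {vq i, vr i}, {vr i, vs i},
      {vs i, vp i}, {vu i, vv i}, {vu i, vp i}, {vv i, vq i}}"

text \<open>
  \<open>c\<close> records, for each \<open>i\<close>, which of the two pairs of edges joins \<open>B\<^sub>i\<close> to \<open>B\<^sub>i\<^sub>+\<^sub>1\<close>.
\<close>

definition joining_edges :: "nat \<Rightarrow> (nat \<Rightarrow> bool) \<Rightarrow> nat \<Rightarrow> snark_vertex set set" where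
  "joining_edges l c i =
     (let j = (i + 1) mod l in
      if c i then {{vs i, vr j}, {vv i, vu j}} else {{vs i, vu j}, {vv i, vr j}})"

text \<open>
  \<open>T\<close> is the set of index triples of the link-vertices and \<open>R\<close> the set of index pairs of the
  repairing edges.
\<close>

definition LP1_choice :: "nat \<Rightarrow> nat set set \<Rightarrow> nat set set \<Rightarrow> bool" where
  "LP1_choice l T R \<longleftrightarrow>
     odd l \<and> l \<ge> 3 \<and>
     (\<forall>X\<in>T. X \<subseteq> {..<l} \<and> card X = 3) \<and> disjoint T \<and>
     odd (card T) \<and> 1 \<le> card T \<and> card T \<le> l div 3 \<and>
     (\<forall>X\<in>R. card X = 2) \<and> disjoint R \<and>
     \<Union>R = {..<l} - \<Union>T"

definition LP1_vertices :: "nat \<Rightarrow> nat set set \<Rightarrow> snark_vertex set" where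
  "LP1_vertices l T = (\<Union>i<l. block_vertices i) \<union> link ` T"

definition LP1_edges ::
    "nat \<Rightarrow> (nat \<Rightarrow> bool) \<Rightarrow> nat set set \<Rightarrow> nat set set \<Rightarrow> snark_vertex set set" where
  "LP1_edges l c T R =
     (\<Union>i<l. block_edges i) \<union> (\<Union>i<l. joining_edges l c i) \<union>
     (\<Union>X\<in>T. {{link X, vt i} | i. i \<in> X}) \<union> (\<lambda>X. vt ` X) ` R"

definition LP1_snark :: "nat \<Rightarrow> 'a set \<Rightarrow> 'a set set \<Rightarrow> bool" where
  "LP1_snark l V E \<longleftrightarrow>
     (\<exists>c T R. LP1_choice l T R \<and>
        graph_isomorphic (LP1_vertices l T) (LP1_edges l c T R) V E)"

definition LP0_snark :: "nat \<Rightarrow> 'a set \<Rightarrow> 'a set set \<Rightarrow> bool" where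
  "LP0_snark l V E \<longleftrightarrow>
     (\<exists>c T R. LP1_choice l T R \<and>
        graph_isomorphic (LP1_vertices l T) (LP1_edges l c T R) V E \<and>
        (\<forall>X\<in>T. \<exists>i<l. X = {i, (i + 1) mod l, (i + 2) mod l}) \<and>
        (\<forall>X\<in>R. \<exists>i<l. X = {i, (i + 1) mod l}))"

end

theory Submission
  imports Defs
begin

text \<open>
  If \<open>D\<close> dominates the graph, then the function with value \<open>k + 1\<close> on \<open>D\<close> and \<open>0\<close> elsewhere is
  \<open>[k]\<close>-Roman dominating, so it suffices to dominate the snark with \<open>2l\<close> vertices. The pair
  \<open>p\<^sub>j, q\<^sub>j\<close> dominates the block \<open>B\<^sub>j\<close>. For a link-vertex \<open>x\<close> adjacent to
  \<open>t\<^sub>i, t\<^sub>i\<^sub>+\<^sub>1, t\<^sub>i\<^sub>+\<^sub>2\<close>, the six vertices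
  \<open>x, s\<^sub>i, v\<^sub>i, t\<^sub>i\<^sub>+\<^sub>1, r\<^sub>i\<^sub>+\<^sub>2, u\<^sub>i\<^sub>+\<^sub>2\<close> dominate \<open>x\<close> and the three blocks
  \<open>B\<^sub>i, B\<^sub>i\<^sub>+\<^sub>1, B\<^sub>i\<^sub>+\<^sub>2\<close>: whichever joining edges are chosen, \<open>{s\<^sub>i, v\<^sub>i}\<close> is matched to
  \<open>{r\<^sub>i\<^sub>+\<^sub>1, u\<^sub>i\<^sub>+\<^sub>1}\<close> and \<open>{s\<^sub>i\<^sub>+\<^sub>1, v\<^sub>i\<^sub>+\<^sub>1}\<close> to \<open>{r\<^sub>i\<^sub>+\<^sub>2, u\<^sub>i\<^sub>+\<^sub>2}\<close>.
\<close>

text \<open>The set \<open>S\<close> to be dominated is a parameter separate from the vertex set, so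
  that domination can be proved block by block and the pieces combined afterwards.\<close>

definition dominates :: "'a set set \<Rightarrow> 'a set \<Rightarrow> 'a set \<Rightarrow> bool" where
  "dominates E D S \<longleftrightarrow> (\<forall>v\<in>S. v \<in> D \<or> (\<exists>d\<in>D. {v, d} \<in> E))"

lemma roman_domination_number_le_dominating:
  fixes V :: "'a set"
  assumes "finite V" and "\<Union>E \<subseteq> V" and "D \<subseteq> V" and "dominates E D V"
  shows "roman_domination_number k V E \<le> (k + 1) * card D"
proof -
  define f where "f v = (if v \<in> D then k + 1 else 0)" for v
  have sum_f: "sum f A = (k + 1) * card (A \<inter> D)" if "finite A" for A
    using that by (simp add: f_def sum.If_cases mult.commute Int_def)
  have "k + card (active_neighborhood E f v) \<le> sum f (closed_neighborhood E v)"
    if v: "v \<in> V" "f v < k" for v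
  proof -
    have v_nin: "v \<notin> D" using v by (auto simp: f_def)
    \<comment> \<open>Neighbourhoods are read off from \<open>E\<close> alone. Confining them to the
      finite set \<open>V\<close> matters because \<open>sum\<close> over an infinite set defaults
      to 0.\<close>
    have "closed_neighborhood E v \<subseteq> V"
      using assms(2) v(1) unfolding closed_neighborhood_def neighborhood_def by blast
    then have fin: "finite (closed_neighborhood E v)"
      using assms(1) by (rule finite_subset)
    have AN: "active_neighborhood E f v = closed_neighborhood E v \<inter> D"
      using v_nin by (auto simp: active_neighborhood_def closed_neighborhood_def f_def)
    have "closed_neighborhood E v \<inter> D \<noteq> {}"
      using assms(4) v v_nin
      by (fastforce simp: dominates_def closed_neighborhood_def neighborhood_def)
    then have "card (closed_neighborhood E v \<inter> D) \<ge> 1"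
      using fin by (simp add: Suc_le_eq card_gt_0_iff)
    \<comment> \<open>With m \<ge> 1 neighbours in \<open>D\<close>, the closed neighbourhood has
      weight (k + 1) m = k m + m \<ge> k + m, and m is also the number of active neighbours.\<close>
    then have "k \<le> k * card (closed_neighborhood E v \<inter> D)" by simp
    then show ?thesis unfolding AN sum_f[OF fin] by (simp add: algebra_simps)
  qed
  then have "roman_dominating k V E f"
    by (simp add: roman_dominating_def f_def)
  then have "roman_domination_number k V E \<le> sum f V"
    unfolding roman_domination_number_def by (intro Least_le) blast
  also have "sum f V = (k + 1) * card D"
    using sum_f[OF assms(1)] assms(3) by (simp add: Int_absorb1)
  finally show ?thesis .
qed

text \<open>Carries a dominating set of the concrete model over to an isomorphic copy; only the
  preservation of edges by \<open>h\<close> matters here.\<close>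

lemma dominates_image:
  assumes "dominates E D S"
  shows "dominates ((`) h ` E) (h ` D) (h ` S)"
  unfolding dominates_def
proof
  fix w assume "w \<in> h ` S"
  then obtain v where v: "v \<in> S" "w = h v" by blast
  have edge: "{h v, h d} \<in> (`) h ` E" if "{v, d} \<in> E" for d
    using imageI[OF that, of "(`) h"] by simp
  from assms v(1) consider "v \<in> D" | d where "d \<in> D" "{v, d} \<in> E"
    unfolding dominates_def by blast
  then show "w \<in> h ` D \<or> (\<exists>d\<in>h ` D. {w, d} \<in> (`) h ` E)"
  proof cases
    case 1
    then show ?thesis using v(2) by simp
  next
    case (2 d)
    then show ?thesis using edge[of d] v(2) by (intro disjI2 bexI[of _ "h d"]) simp_all
  qed
qed

lemma finite_LP1_vertices: "finite T \<Longrightarrow> finite (LP1_vertices l T)"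
  by (simp add: LP1_vertices_def block_vertices_def)

lemma Union_LP1_edges_subset:
  assumes "LP1_choice l T R"
  shows "\<Union>(LP1_edges l c T R) \<subseteq> LP1_vertices l T"
proof (rule Union_least)
  have vt: "vt i \<in> LP1_vertices l T" if "i < l" for i
    using that by (auto simp: LP1_vertices_def block_vertices_def)
  have "X \<subseteq> {..<l}" if "X \<in> T" for X
    using assms that by (auto simp: LP1_choice_def)
  then have triple: "i < l" if "X \<in> T" "i \<in> X" for X i
    using that by blast
  have "\<Union>R \<subseteq> {..<l}"
    using assms by (auto simp: LP1_choice_def)
  then have repair: "i < l" if "X \<in> R" "i \<in> X" for X i
    using that by blast
  fix e assume "e \<in> LP1_edges l c T R"
  then consider i where "i < l" "e \<in> block_edges i" | i where "i < l" "e \<in> joining_edges l c i"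
    | X i where "X \<in> T" "i \<in> X" "e = {link X, vt i}" | X where "X \<in> R" "e = vt ` X"
    unfolding LP1_edges_def by blast
  then show "e \<subseteq> LP1_vertices l T"
  proof cases
    case 1
    then show ?thesis
      by (auto simp: block_edges_def LP1_vertices_def block_vertices_def)
  next
    case 2
    then have "(i + 1) mod l < l" by simp
    with 2 show ?thesis
      by (auto simp: joining_edges_def LP1_vertices_def block_vertices_def Let_def
          split: if_splits)
  next
    case 3
    moreover have "link X \<in> LP1_vertices l T"
      using 3(1) by (simp add: LP1_vertices_def)
    ultimately show ?thesis using vt[OF triple] by simp
  next
    case 4
    then show ?thesis using vt[OF repair] by blast
  qed
qed

lemma pq_dominates_block:
  assumes "j < l"
  shows "dominates (LP1_edges l c T R) {vp j, vq j} (block_vertices j)"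
proof -
  have "block_edges j \<subseteq> LP1_edges l c T R"
    using assms by (auto simp: LP1_edges_def)
  then show ?thesis
    by (auto simp: dominates_def block_vertices_def block_edges_def insert_commute)
qed

definition triple_dominators :: "nat \<Rightarrow> nat \<Rightarrow> snark_vertex set" where
  "triple_dominators l i =
     {link {i, (i + 1) mod l, (i + 2) mod l}, vs i, vv i, vt ((i + 1) mod l),
      vr ((i + 2) mod l), vu ((i + 2) mod l)}"

lemma card_triple_dominators_le: "card (triple_dominators l i) \<le> 6"
  unfolding triple_dominators_def
  \<comment> \<open>A set listed with six entries has at most six elements, so the entries need not
    be shown distinct.\<close>
  by (rule order_trans[OF card_length[of "[_, _, _, _, _, _]", simplified list.set]]) simp

lemma triple_dominators_dominates:
  assumes "i < l" and X: "X = {i, (i + 1) mod l, (i + 2) mod l}" and "X \<in> T"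
  shows "dominates (LP1_edges l c T R) (triple_dominators l i)
           (insert (link X) (\<Union>j\<in>X. block_vertices j))"
proof -
  define a b where "a = (i + 1) mod l" and "b = (i + 2) mod l"
  \<comment> \<open>The last equation says that the joining edges leaving block \<open>a\<close>
    enter block \<open>b\<close>.\<close>
  have ab: "a < l" "b < l" "(a + 1) mod l = b"
    using assms(1) by (auto simp: a_def b_def mod_Suc_eq)
  let ?E = "LP1_edges l c T R"
  have block: "block_edges j \<subseteq> ?E" if "j < l" for j
    using that by (auto simp: LP1_edges_def)
  have join: "joining_edges l c j \<subseteq> ?E" if "j < l" for j
    using that by (auto simp: LP1_edges_def)
  have linked: "{vt j, link X} \<in> ?E" if "j \<in> X" for j
    using that assms(3) by (auto simp: LP1_edges_def insert_commute)
  \<comment> \<open>The existential quantifiers hide which of the two pairs of joining edges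
    \<open>c\<close> selects.\<close>
  have join_i: "(\<exists>d\<in>{vs i, vv i}. {vr a, d} \<in> ?E) \<and> (\<exists>d\<in>{vs i, vv i}. {vu a, d} \<in> ?E)"
    using join[OF assms(1)]
    unfolding joining_edges_def Let_def a_def[symmetric]
    by (auto simp: insert_commute split: if_splits)
  have join_a: "(\<exists>d\<in>{vr b, vu b}. {vs a, d} \<in> ?E) \<and> (\<exists>d\<in>{vr b, vu b}. {vv a, d} \<in> ?E)"
    using join[OF ab(1)] unfolding joining_edges_def Let_def ab(3)
    by (auto simp: insert_commute split: if_splits)
  have D: "triple_dominators l i = {link X, vs i, vv i, vt a, vr b, vu b}"
    by (simp add: triple_dominators_def X a_def b_def)
  \<comment> \<open>In block \<open>i\<close>, \<open>vs i\<close> reaches r and p,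
    \<open>vv i\<close> reaches u and q, and the link-vertex reaches t.\<close>
  have "dominates ?E (triple_dominators l i) (block_vertices i)"
    using block[OF assms(1)] linked[of i] unfolding D
    by (auto simp: X dominates_def block_vertices_def block_edges_def insert_commute)
  \<comment> \<open>In the middle block, \<open>vt a\<close> reaches p and q; the other four
    vertices are reached from the two outer blocks.\<close>
  moreover have "dominates ?E (triple_dominators l i) (block_vertices a)"
    using block[OF ab(1)] join_i join_a unfolding D
    by (auto simp: dominates_def block_vertices_def block_edges_def insert_commute)
  \<comment> \<open>In block \<open>b\<close>, \<open>vr b\<close> reaches q and s,
    \<open>vu b\<close> reaches p and v, and the link-vertex reaches t.\<close>
  moreover have "dominates ?E (triple_dominators l i) (block_vertices b)"
    using block[OF ab(2)] linked[of b] unfolding D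
    by (auto simp: X b_def dominates_def block_vertices_def block_edges_def insert_commute)
  ultimately have "dominates ?E (triple_dominators l i) (block_vertices j)" if "j \<in> X" for j
    using that unfolding X a_def[symmetric] b_def[symmetric] by (elim insertE emptyE) simp_all
  moreover have "link X \<in> triple_dominators l i"
    by (simp add: D)
  ultimately show ?thesis
    unfolding dominates_def by blast
qed

lemma triple_dominators_subset:
  assumes "i < l" and "{i, (i + 1) mod l, (i + 2) mod l} \<in> T"
  shows "triple_dominators l i \<subseteq> LP1_vertices l T"
proof -
  have "(i + 1) mod l < l" "(i + 2) mod l < l" using assms(1) by auto
  then show ?thesis using assms
    by (auto simp: triple_dominators_def LP1_vertices_def block_vertices_def)
qed

lemma LP0_dominating_set:
  assumes "LP1_choice l T R"
    and "\<forall>X\<in>T. \<exists>i<l. X = {i, (i + 1) mod l, (i + 2) mod l}"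
  obtains D where "D \<subseteq> LP1_vertices l T"
    and "dominates (LP1_edges l c T R) D (LP1_vertices l T)" and "card D \<le> 2 * l"
proof -
  \<comment> \<open>A starting index is chosen for each triple; for l = 3 every index would
    do.\<close>
  obtain idx where "\<forall>X\<in>T. idx X < l \<and> X = {idx X, (idx X + 1) mod l, (idx X + 2) mod l}"
    using bchoice[OF assms(2)] ..
  then have idx: "idx X < l" "X = {idx X, (idx X + 1) mod l, (idx X + 2) mod l}"
    if "X \<in> T" for X
    using that by blast+
  let ?C = "{..<l} - \<Union>T"
  let ?P = "\<Union>j\<in>?C. {vp j, vq j}" and ?Q = "\<Union>X\<in>T. triple_dominators l (idx X)"
  let ?E = "LP1_edges l c T R"
  have T: "\<forall>X\<in>T. X \<subseteq> {..<l} \<and> card X = 3" "disjoint T"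
    using assms(1) by (auto simp: LP1_choice_def)
  have fin: "finite T"
    using T(1) by (intro finite_subset[of T "Pow {..<l}"]) auto
  have "?P \<subseteq> LP1_vertices l T"
    by (auto simp: LP1_vertices_def block_vertices_def)
  moreover have "?Q \<subseteq> LP1_vertices l T"
    using triple_dominators_subset idx(1) idx(2)[symmetric] by (intro UN_least) simp
  ultimately have sub: "?P \<union> ?Q \<subseteq> LP1_vertices l T" by blast
  have mono: "dominates ?E D' S" if "dominates ?E D S" "D \<subseteq> D'" for D D' S
    using that unfolding dominates_def by blast
  have free: "dominates ?E (?P \<union> ?Q) (block_vertices j)" if "j \<in> ?C" for j
    using that by (intro mono[OF pq_dominates_block]) auto
  have covered: "dominates ?E (?P \<union> ?Q) (insert (link X) (\<Union>j\<in>X. block_vertices j))"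
    if "X \<in> T" for X
    using that by (intro mono[OF triple_dominators_dominates[OF idx]]) auto
  have dom: "dominates ?E (?P \<union> ?Q) (LP1_vertices l T)"
    unfolding dominates_def
  proof
    fix v assume v: "v \<in> LP1_vertices l T"
    have "\<exists>S. v \<in> S \<and> dominates ?E (?P \<union> ?Q) S"
    proof (cases "v \<in> link ` T")
      case True
      then show ?thesis using covered by blast
    next
      case False
      with v obtain j where j: "j < l" "v \<in> block_vertices j"
        unfolding LP1_vertices_def by blast
      show ?thesis
      proof (cases "j \<in> \<Union>T")
        case True
        then obtain X where X: "X \<in> T" "j \<in> X" ..
        then have "v \<in> insert (link X) (\<Union>j\<in>X. block_vertices j)"
          using j(2) by (intro insertI2 UN_I)
        with covered[OF X(1)] show ?thesis by (intro exI conjI)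
      next
        case False
        with j(1) have "j \<in> ?C" by simp
        from j(2) free[OF this] show ?thesis by (intro exI conjI)
      qed
    qed
    then obtain S where "v \<in> S" "dominates ?E (?P \<union> ?Q) S" by (elim exE conjE)
    then show "v \<in> ?P \<union> ?Q \<or> (\<exists>d\<in>?P \<union> ?Q. {v, d} \<in> ?E)"
      unfolding dominates_def by (elim bspec)
  qed
  \<comment> \<open>Disjoint triples use up exactly 3 |T| blocks. Two vertices per remaining block
    and at most six per triple then give 2 (l - 3 |T|) + 6 |T| = 2 l.\<close>
  have "card (\<Union>T) = (\<Sum>X\<in>T. card X)"
    using T by (intro card_Union_disjoint) (auto intro: finite_subset)
  then have card_Union: "card (\<Union>T) = 3 * card T"
    using T(1) by simp
  have "\<Union>T \<subseteq> {..<l}" using T(1) by blast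
  then have card_C: "card ?C + 3 * card T = l"
    using card_Union card_mono[of "{..<l}" "\<Union>T"]
    by (simp add: card_Diff_subset finite_subset)
  have "card ?P \<le> (\<Sum>j\<in>?C. card {vp j, vq j})"
    by (rule card_UN_le) simp
  then have card_P: "card ?P \<le> 2 * card ?C" by simp
  have "card ?Q \<le> (\<Sum>X\<in>T. card (triple_dominators l (idx X)))"
    using fin by (rule card_UN_le)
  also have "\<dots> \<le> card T * 6"
    using sum_bounded_above[of T _ "6::nat"] card_triple_dominators_le by simp
  finally have "card (?P \<union> ?Q) \<le> 2 * l"
    using card_P card_C card_Un_le[of ?P ?Q] by linarith
  with sub dom show ?thesis by (rule that)
qed

theorem theorem5p3:
  fixes k l :: nat and V :: "'a set" and E :: "'a set set"
  assumes "k \<ge> 1" and "odd l" and "l \<ge> 3"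
    and "LP0_snark l V E"
  shows "roman_domination_number k V E \<le> 2 * (k + 1) * l"
proof -
  obtain c T R h where choice: "LP1_choice l T R"
    and h: "bij_betw h (LP1_vertices l T) V" "E = (`) h ` LP1_edges l c T R"
    and triples: "\<forall>X\<in>T. \<exists>i<l. X = {i, (i + 1) mod l, (i + 2) mod l}"
    using assms(4) unfolding LP0_snark_def graph_isomorphic_def by (elim exE conjE)
  obtain D where D: "D \<subseteq> LP1_vertices l T"
    "dominates (LP1_edges l c T R) D (LP1_vertices l T)" "card D \<le> 2 * l"
    using LP0_dominating_set[OF choice triples] .
  have V: "V = h ` LP1_vertices l T"
    using h(1) by (simp add: bij_betw_def)
  have "finite T"
    using choice by (intro finite_subset[of T "Pow {..<l}"]) (auto simp: LP1_choice_def)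
  then have fin: "finite (LP1_vertices l T)" by (rule finite_LP1_vertices)
  have "roman_domination_number k V E \<le> (k + 1) * card (h ` D)"
  proof (rule roman_domination_number_le_dominating)
    show "finite V" using fin V by simp
    show "\<Union>E \<subseteq> V"
      using image_mono[OF Union_LP1_edges_subset[OF choice], of h c]
      unfolding V h(2) by (simp only: image_Union)
    show "h ` D \<subseteq> V" using D(1) V by blast
    show "dominates E (h ` D) V"
      unfolding V h(2) using D(2) by (rule dominates_image)
  qed
  also have "\<dots> \<le> (k + 1) * (2 * l)"
    using card_image_le[OF finite_subset[OF D(1) fin], of h] D(3) by (intro mult_le_mono) auto
  finally show ?thesis by (simp add: algebra_simps)
qed

end
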